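(* Let $X$ and $Y$ be compact Hausdorff spaces. There exists a bijective and multiplicative map $\varphi: C(X,I) \to C(Y,I)$ that is not standard if and only if $X$ and $Y$ are homeomorphic and there exists a subset $Z$ of $Y$, not pseudocompact (in the subspace topology), such that $Y = \beta Z$.
   Context: $I = [0,1]$, and $C(X,I)$ is the semigroup, under pointwise multiplication, of all continuous functions $X \to I$. A map $\varphi: C(X,I) \to C(Y,I)$ is multiplicative if $\varphi(fg) = \varphi(f)\varphi(g)$ for all $f,g$. It is called standard if there exist a homeomorphism $\mu: Y \to X$ and a continuous map $p: Y \to (0,+\infty)$ such that $\varphi(f)(y) = f(\mu(y))^{p(y)}$ for every $f \in C(X,I)$ and every $y \in Y$. A topological space $Z$ is pseudocompact if every real-valued continuous function on $Z$ is bounded. $\beta Z$ denotes the Stone–Čech compactification of $Z$; for a subset $Z \subset Y$ with the subspace topology, $Y = \beta Z$ means that $Y$ together with the inclusion $Z \hookrightarrow Y$ is the Stone–Čech compactification of $Z$, i.e. $Z$ is dense in $Y$ and every continuous function $Z \to [0,1]$ extends to a continuous function $Y \to [0,1]$. *)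

theory Defs
  imports "HOL-Analysis.Analysis"
begin

(* Spaces are HOL-Analysis topologies, so the empty space and arbitrary carriers are allowed.
   Functions on a space X are taken to be extensional on topspace X, so that HOL equality
   of elements of CI X is equality of functions X -> [0,1]. *)
definition CI :: "'a topology \<Rightarrow> ('a \<Rightarrow> real) set" where
  "CI X = {f \<in> extensional (topspace X). continuous_map X (top_of_set {0..1}) f}"

definition CI_mult :: "'a topology \<Rightarrow> ('a \<Rightarrow> real) \<Rightarrow> ('a \<Rightarrow> real) \<Rightarrow> 'a \<Rightarrow> real" where
  "CI_mult X f g = (\<lambda>x\<in>topspace X. f x * g x)"

lemma CI_mult_closed:
  assumes "f \<in> CI X" "g \<in> CI X"
  shows "CI_mult X f g \<in> CI X"
proof -
  have c: "continuous_map X euclideanreal f" "continuous_map X euclideanreal g"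
    and r: "\<And>x. x \<in> topspace X \<Longrightarrow> 0 \<le> f x \<and> f x \<le> 1 \<and> 0 \<le> g x \<and> g x \<le> 1"
    using assms by (auto simp: CI_def continuous_map_in_subtopology)
  have "continuous_map X euclideanreal (\<lambda>x. f x * g x)"
    using c by (rule continuous_map_real_mult)
  then have "continuous_map X euclideanreal (CI_mult X f g)"
    by (rule continuous_map_eq) (simp add: CI_mult_def)
  with r show ?thesis
    by (auto simp: CI_def CI_mult_def continuous_map_in_subtopology mult_le_one)
qed

definition multiplicative_map ::
    "'a topology \<Rightarrow> 'b topology \<Rightarrow> (('a \<Rightarrow> real) \<Rightarrow> 'b \<Rightarrow> real) \<Rightarrow> bool" where
  "multiplicative_map X Y \<phi> \<longleftrightarrow>
     \<phi> \<in> CI X \<rightarrow> CI Y \<and>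
     (\<forall>f \<in> CI X. \<forall>g \<in> CI X. \<phi> (CI_mult X f g) = CI_mult Y (\<phi> f) (\<phi> g))"

(* The exponent is positive, so the convention 0 powr a = 0 gives the usual power of 0. *)
definition standard_map ::
    "'a topology \<Rightarrow> 'b topology \<Rightarrow> (('a \<Rightarrow> real) \<Rightarrow> 'b \<Rightarrow> real) \<Rightarrow> bool" where
  "standard_map X Y \<phi> \<longleftrightarrow>
     (\<exists>\<mu> p. homeomorphic_map Y X \<mu> \<and> continuous_map Y (top_of_set {0<..}) p \<and>
        (\<forall>f \<in> CI X. \<forall>y \<in> topspace Y. \<phi> f y = f (\<mu> y) powr p y))"

definition pseudocompact_space :: "'a topology \<Rightarrow> bool" where
  "pseudocompact_space Z \<longleftrightarrow>
     (\<forall>f. continuous_map Z euclideanreal f \<longrightarrow> bounded (f ` topspace Z))"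

(* Y = beta Z for a subset Z of Y, with the inclusion as the compactification map. *)
definition stone_cech_of_subset :: "'a topology \<Rightarrow> 'a set \<Rightarrow> bool" where
  "stone_cech_of_subset Y Z \<longleftrightarrow>
     compact_space Y \<and> Hausdorff_space Y \<and>
     Z \<subseteq> topspace Y \<and> Y closure_of Z = topspace Y \<and>
     (\<forall>f. continuous_map (subtopology Y Z) (top_of_set {0..1::real}) f \<longrightarrow>
        (\<exists>g. continuous_map Y (top_of_set {0..1::real}) g \<and> (\<forall>z \<in> Z. g z = f z)))"

end

(* A multiplicative bijection phi determines a homeomorphism mu : Y -> X by zero products, and
   phi f y depends only on the germ of f at mu y. Let gamma be the image of the constant 1/e and
   Z = {0 < gamma < 1}, which is open and dense. On Z, phi f y = f (mu y) powr p y with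
   p = - ln gamma. If Z is all of Y, phi is standard; otherwise 1 / (gamma * (1 - gamma)) is
   unbounded on Z, and functions on Z extend to Y because exp (- f) is the product of
   phi (h o inverse mu) and (inverse phi) h o mu, where h = exp (- f * p / (1 + p^2)).
   Conversely, an unbounded u on Z gives the nonstandard map f |-> (f o h) powr (1 + |u|) on Z,
   extended to Y, where h : Y -> X is a homeomorphism. *)
theory Submission
  imports Defs
begin

section \<open>The semigroup of continuous functions into the unit interval\<close>

lemma CI_D:
  assumes "f \<in> CI X"
  shows "continuous_map X euclideanreal f" "x \<in> topspace X \<Longrightarrow> 0 \<le> f x"
    "x \<in> topspace X \<Longrightarrow> f x \<le> 1" "f \<in> extensional (topspace X)"
  using assms by (auto simp: CI_def continuous_map_in_subtopology Pi_iff)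

lemma restrict_in_CI:
  assumes "continuous_map X euclideanreal f" "\<And>x. x \<in> topspace X \<Longrightarrow> f x \<in> {0..1}"
  shows "restrict f (topspace X) \<in> CI X"
proof -
  have "continuous_map X euclideanreal (restrict f (topspace X))"
    using assms(1) by (rule continuous_map_eq) simp
  with assms(2) show ?thesis
    by (auto simp: CI_def continuous_map_in_subtopology)
qed

lemma CI_eqI:
  assumes "f \<in> CI X" "g \<in> CI X" "\<And>x. x \<in> topspace X \<Longrightarrow> f x = g x"
  shows "f = g"
  using assms CI_D(4) extensionalityI by metis

lemma CI_mult_apply [simp]: "x \<in> topspace X \<Longrightarrow> CI_mult X f g x = f x * g x"
  by (simp add: CI_mult_def)

text \<open>Serves twice below: with \<open>S\<close> the set where an image function is nonzero,
  and with \<open>S\<close> a dense set.\<close>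

lemma CI_ext_closure:
  assumes "f \<in> CI X" "g \<in> CI X" "x \<in> X closure_of S" "\<And>s. s \<in> S \<Longrightarrow> f s = g s"
  shows "f x = g x"
  using forall_in_closure_of_eq[OF assms(3) Hausdorff_space_euclidean CI_D(1)[OF assms(1)] CI_D(1)[OF assms(2)]]
    assms(4) by blast

definition CI_const :: "'a topology \<Rightarrow> real \<Rightarrow> 'a \<Rightarrow> real" where
  "CI_const X c = (\<lambda>x\<in>topspace X. c)"

lemma CI_const_apply [simp]: "x \<in> topspace X \<Longrightarrow> CI_const X c x = c"
  by (simp add: CI_const_def)

lemma CI_const_in_CI [simp]: "0 \<le> c \<Longrightarrow> c \<le> 1 \<Longrightarrow> CI_const X c \<in> CI X"
  unfolding CI_const_def by (rule restrict_in_CI) auto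

lemma CI_mult_const: "CI_mult X (CI_const X a) (CI_const X b) = CI_const X (a * b)"
  by (auto simp: CI_mult_def CI_const_def)

lemma CI_mult_commute: "CI_mult X f g = CI_mult X g f"
  by (auto simp: CI_mult_def mult.commute)

lemma CI_mult_zero_left: "CI_mult X (CI_const X 0) f = CI_const X 0"
  by (auto simp: CI_mult_def CI_const_def)

lemma CI_mult_one_left: "f \<in> CI X \<Longrightarrow> CI_mult X (CI_const X 1) f = f"
  by (rule CI_eqI) (auto intro: CI_mult_closed)

lemma CI_eq_zero_iff:
  "f \<in> CI X \<Longrightarrow> f = CI_const X 0 \<longleftrightarrow> (\<forall>x\<in>topspace X. f x = 0)"
  using CI_eqI[of f X "CI_const X 0"] by fastforce

text \<open>The delicate points are the zeros of \<open>f\<close>. Continuity survives there because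
  the exponent has a positive limit and \<open>f\<close> is nonnegative nearby.\<close>

lemma continuous_map_real_powr:
  assumes "continuous_map X euclideanreal f" "continuous_map X euclideanreal p"
    and "\<And>x. x \<in> topspace X \<Longrightarrow> 0 \<le> f x" "\<And>x. x \<in> topspace X \<Longrightarrow> 0 < p x"
  shows "continuous_map X euclideanreal (\<lambda>x. f x powr p x)"
proof -
  have "((\<lambda>z. f z powr p z) \<longlongrightarrow> f x powr p x) (atin X x)" if "x \<in> topspace X" for x
  proof (rule tendsto_powr')
    show "(f \<longlongrightarrow> f x) (atin X x)" "(p \<longlongrightarrow> p x) (atin X x)"
      using assms(1,2) that by (auto simp: continuous_map_atin)
    have "\<forall>\<^sub>F z in atin X x. 0 \<le> f z"
      unfolding eventually_atin using assms(3) that openin_topspace by (metis Diff_iff)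
    then show "f x \<noteq> 0 \<or> 0 < p x \<and> (\<forall>\<^sub>F z in atin X x. 0 \<le> f z)"
      using assms(4) that by simp
  qed
  then show ?thesis by (simp add: continuous_map_atin)
qed

lemma exp_powr: "exp (a::real) powr b = exp (a * b)"
  by (simp add: powr_def mult.commute)

lemma continuous_map_real_epsilon:
  assumes "\<And>x e. x \<in> topspace X \<Longrightarrow> 0 < e \<Longrightarrow>
      \<exists>T. openin X T \<and> x \<in> T \<and> (\<forall>z\<in>T. \<bar>f z - f x\<bar> < (e::real))"
  shows "continuous_map X euclideanreal f"
proof -
  have "(f \<longlongrightarrow> f x) (atin X x)" if x: "x \<in> topspace X" for x
  proof (rule tendstoI)
    fix e :: real assume "0 < e"
    from assms[OF x this] show "\<forall>\<^sub>F z in atin X x. dist (f z) (f x) < e"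
      unfolding eventually_atin dist_real_def by (metis Diff_iff)
  qed
  then show ?thesis by (simp add: continuous_map_atin)
qed

lemma openin_less:
  assumes "continuous_map X euclideanreal f" "continuous_map X euclideanreal g"
  shows "openin X {x \<in> topspace X. f x < g x}"
proof -
  have "openin X {x \<in> topspace X. g x - f x \<in> {0<..}}"
    by (rule openin_continuous_map_preimage[where Y=euclideanreal])
      (auto intro!: continuous_map_diff assms)
  then show ?thesis by simp
qed

lemma openin_nonzero:
  assumes "f \<in> CI X"
  shows "openin X {x \<in> topspace X. f x \<noteq> 0}"
proof -
  have "{x \<in> topspace X. f x \<noteq> 0} = {x \<in> topspace X. 0 < f x}"
    using CI_D(2)[OF assms] by force
  then show ?thesis
    using openin_less[OF _ CI_D(1)[OF assms], of "\<lambda>_. 0"] by auto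
qed

text \<open>Urysohn prescribes values only on closed sets. Arguments about germs need them on the
  open sets \<open>V\<close> and \<open>W\<close>, so that products with another function are known
  on neighbourhoods.\<close>

lemma compact_Hausdorff_bump:
  assumes "compact_space X" "Hausdorff_space X" "openin X U" "x \<in> U"
  obtains h V W where "h \<in> CI X" "openin X V" "x \<in> V" "\<And>v. v \<in> V \<Longrightarrow> h v = 1"
    "openin X W" "topspace X - U \<subseteq> W" "\<And>w. w \<in> W \<Longrightarrow> h w = 0"
proof -
  have x: "x \<in> topspace X" using assms openin_subset by blast
  have n: "normal_space X"
    using assms compact_Hausdorff_or_regular_imp_normal_space by blast
  have c1: "closedin X {x}"
    using closedin_Hausdorff_sing_eq[OF assms(2)] x by simp
  have c2: "closedin X (topspace X - U)" using assms(3) by blast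
  have "disjnt (topspace X - U) {x}" using assms(4) by auto
  then obtain f where f: "continuous_map X (top_of_set {0..1::real}) f"
    "f ` (topspace X - U) \<subseteq> {0}" "f ` {x} \<subseteq> {1}"
    using Urysohn_lemma[OF n c2 c1 _ zero_le_one] by metis
  have c: "continuous_map X euclideanreal f"
    using f(1) continuous_map_into_fulltopology by blast
  \<comment> \<open>Stretching the middle third of \<open>[0,1]\<close> and clamping makes the
    function constant wherever \<open>f\<close> exceeds 2/3 or lies below 1/3.\<close>
  let ?h = "restrict (\<lambda>z. max 0 (min 1 (3 * f z - 1))) (topspace X)"
  show thesis
  proof (rule that)
    show "?h \<in> CI X"
      by (rule restrict_in_CI) (auto intro!: continuous_intros c)
    show "openin X {z \<in> topspace X. 2/3 < f z}" "openin X {z \<in> topspace X. f z < 1/3}"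
      using openin_less[OF _ c, of "\<lambda>_. 2/3"] openin_less[OF c, of "\<lambda>_. 1/3"] by auto
  qed (use f x in auto)
qed

section \<open>Multiplicative bijections\<close>

text \<open>The inverse is a parameter, so the situation is symmetric. Once \<open>psi_mult\<close>
  is known, \<open>dual\<close> makes each result available for the inverse as well.\<close>

locale CI_iso =
  fixes X :: "'a topology" and Y :: "'b topology" and \<phi> \<psi>
  assumes X: "compact_space X" "Hausdorff_space X"
    and Y: "compact_space Y" "Hausdorff_space Y"
    and phi: "f \<in> CI X \<Longrightarrow> \<phi> f \<in> CI Y"
    and psi: "g \<in> CI Y \<Longrightarrow> \<psi> g \<in> CI X"
    and psi_phi: "f \<in> CI X \<Longrightarrow> \<psi> (\<phi> f) = f"
    and phi_psi: "g \<in> CI Y \<Longrightarrow> \<phi> (\<psi> g) = g"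
    and phi_mult: "\<lbrakk>f \<in> CI X; f' \<in> CI X\<rbrakk> \<Longrightarrow> \<phi> (CI_mult X f f') = CI_mult Y (\<phi> f) (\<phi> f')"
begin

lemma psi_mult:
  assumes "f \<in> CI Y" "g \<in> CI Y"
  shows "\<psi> (CI_mult Y f g) = CI_mult X (\<psi> f) (\<psi> g)"
  by (metis assms CI_mult_closed phi_mult phi_psi psi psi_phi)

lemma dual: "CI_iso Y X \<psi> \<phi>"
  by unfold_locales (auto simp: X Y phi psi psi_phi phi_psi psi_mult)

text \<open>Zero is the absorbing element of the semigroup. Surjectivity enters through the preimage
  of zero, which the zero of \<open>CI X\<close> absorbs.\<close>

lemma phi_zero: "\<phi> (CI_const X 0) = CI_const Y 0"
proof -
  have "CI_mult X (CI_const X 0) (\<psi> (CI_const Y 0)) = CI_const X 0"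
    by (rule CI_mult_zero_left)
  then have "CI_mult Y (\<phi> (CI_const X 0)) (CI_const Y 0) = \<phi> (CI_const X 0)"
    by (metis CI_const_in_CI order.refl phi_mult phi_psi psi zero_le_one)
  then show ?thesis by (metis CI_mult_commute CI_mult_zero_left)
qed

lemma phi_one: "\<phi> (CI_const X 1) = CI_const Y 1"
proof -
  have "CI_mult X (CI_const X 1) (\<psi> (CI_const Y 1)) = \<psi> (CI_const Y 1)"
    by (simp add: CI_mult_one_left psi)
  then have "CI_mult Y (\<phi> (CI_const X 1)) (CI_const Y 1) = CI_const Y 1"
    by (metis CI_const_in_CI order.refl phi_mult phi_psi psi zero_le_one)
  then show ?thesis by (simp add: CI_mult_commute CI_mult_one_left phi)
qed

lemma phi_apply_mult:
  "\<lbrakk>f \<in> CI X; g \<in> CI X; y \<in> topspace Y\<rbrakk> \<Longrightarrow> \<phi> (CI_mult X f g) y = \<phi> f y * \<phi> g y"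
  by (simp add: phi_mult)

section \<open>Points related by nonvanishing products\<close>

text \<open>The graph of the underlying homeomorphism, in a form symmetric in \<open>\<phi>\<close> and \<open>\<psi>\<close>.\<close>

definition rel :: "'a \<Rightarrow> 'b \<Rightarrow> bool" where
  "rel x y \<longleftrightarrow> x \<in> topspace X \<and> y \<in> topspace Y \<and>
     (\<forall>f\<in>CI X. \<forall>g\<in>CI Y. f x \<noteq> 0 \<longrightarrow> g y \<noteq> 0 \<longrightarrow> CI_mult Y (\<phi> f) g \<noteq> CI_const Y 0)"

text \<open>Applying \<open>\<psi>\<close> to the product of \<open>\<phi> f\<close> and
  \<open>g\<close> gives the product of \<open>f\<close> and \<open>\<psi> g\<close>, and zero is
  preserved both ways, so the two products vanish together.\<close>

lemma rel_dual: "CI_iso.rel Y X \<psi> y x \<longleftrightarrow> rel x y"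
proof -
  interpret D: CI_iso Y X \<psi> \<phi> by (rule dual)
  have eq: "CI_mult Y (\<phi> f) g = CI_const Y 0 \<longleftrightarrow> CI_mult X (\<psi> g) f = CI_const X 0"
    if fg: "f \<in> CI X" "g \<in> CI Y" for f g
  proof -
    have "\<psi> (CI_mult Y (\<phi> f) g) = CI_mult X (\<psi> g) f"
      using fg by (simp add: psi_mult phi psi_phi CI_mult_commute)
    moreover have "CI_mult Y (\<phi> f) g \<in> CI Y" using fg by (simp add: CI_mult_closed phi)
    ultimately show ?thesis
      by (metis D.phi_zero phi_psi phi_zero)
  qed
  show ?thesis
  proof
    assume "D.rel y x" then show "rel x y"
      unfolding rel_def D.rel_def using eq by simp
  next
    assume "rel x y" then show "D.rel y x"
      unfolding rel_def D.rel_def using eq by simp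
  qed
qed

text \<open>If \<open>\<phi> f\<close> vanished near \<open>y\<close>, a bump at \<open>y\<close>
  supported in that neighbourhood would annihilate \<open>\<phi> f\<close>, which the relation
  forbids.\<close>

lemma rel_closure:
  assumes "rel x y" "f \<in> CI X" "f x \<noteq> 0"
  shows "y \<in> Y closure_of {z \<in> topspace Y. \<phi> f z \<noteq> 0}"
proof (rule ccontr)
  assume neg: "\<not> ?thesis"
  have y: "y \<in> topspace Y" using assms rel_def by blast
  then obtain T where T: "openin Y T" "y \<in> T" "\<And>z. z \<in> T \<Longrightarrow> \<phi> f z = 0"
    using neg openin_subset unfolding in_closure_of by blast
  obtain h V W where h: "h \<in> CI Y" "y \<in> V" "\<And>v. v \<in> V \<Longrightarrow> h v = 1"
     "topspace Y - T \<subseteq> W" "\<And>w. w \<in> W \<Longrightarrow> h w = 0"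
    using compact_Hausdorff_bump[OF Y T(1,2)] by metis
  have "CI_mult Y (\<phi> f) h = CI_const Y 0"
    using h T(3) by (subst CI_eq_zero_iff) (auto intro!: CI_mult_closed phi assms)
  moreover have "h y \<noteq> 0" using h by auto
  ultimately show False using assms h(1) rel_def by blast
qed

text \<open>A compactness argument. If every \<open>y\<close> is excluded by a pair
  \<open>F y\<close>, \<open>G y\<close>, then finitely many sets \<open>G y \<noteq> 0\<close>
  cover \<open>Y\<close>. The product of the corresponding \<open>F y\<close> is nonzero at
  \<open>x\<close>, while its image vanishes everywhere, against injectivity.\<close>

lemma rel_total:
  assumes x: "x \<in> topspace X"
  shows "\<exists>y. rel x y"
proof (rule ccontr)
  assume neg: "\<nexists>y. rel x y"
  then have "\<forall>y. \<exists>f g. y \<in> topspace Y \<longrightarrow>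
      f \<in> CI X \<and> g \<in> CI Y \<and> f x \<noteq> 0 \<and> g y \<noteq> 0 \<and> CI_mult Y (\<phi> f) g = CI_const Y 0"
    unfolding rel_def using x by blast
  then obtain F G where FG: "\<And>y. y \<in> topspace Y \<Longrightarrow> F y \<in> CI X \<and> G y \<in> CI Y \<and> F y x \<noteq> 0 \<and> G y y \<noteq> 0
      \<and> CI_mult Y (\<phi> (F y)) (G y) = CI_const Y 0"
    by metis
  define U where "U y = {z \<in> topspace Y. G y z \<noteq> 0}" for y
  have "\<forall>V \<in> U ` topspace Y. openin Y V" "topspace Y \<subseteq> \<Union>(U ` topspace Y)"
    using FG openin_nonzero by (auto simp: U_def)
  then obtain \<F> where "finite \<F>" "\<F> \<subseteq> U ` topspace Y" "topspace Y \<subseteq> \<Union>\<F>"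
    using Y(1) unfolding compact_space_alt by meson
  then obtain S where S: "finite S" "S \<subseteq> topspace Y" "topspace Y \<subseteq> \<Union>(U ` S)"
    by (metis finite_subset_image)
  have "\<exists>f \<in> CI X. f x \<noteq> 0 \<and> (\<forall>y\<in>S. \<forall>z\<in>topspace Y. \<phi> (F y) z = 0 \<longrightarrow> \<phi> f z = 0)"
    using S(1,2)
  proof (induction S rule: finite_induct)
    case empty
    \<comment> \<open>The empty product. This case also settles an empty \<open>Y\<close>, where the
      image of 1 is the zero function.\<close>
    show ?case using x by (intro bexI[of _ "CI_const X 1"]) auto
  next
    case (insert a S)
    then obtain f where f: "f \<in> CI X" "f x \<noteq> 0" "\<forall>y\<in>S. \<forall>z\<in>topspace Y. \<phi> (F y) z = 0 \<longrightarrow> \<phi> f z = 0"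
      by auto
    have "F a \<in> CI X" "F a x \<noteq> 0" using FG insert by auto
    with f show ?case using x
      by (intro bexI[of _ "CI_mult X (F a) f"]) (auto simp: phi_apply_mult CI_mult_closed)
  qed
  then obtain f where f: "f \<in> CI X" "f x \<noteq> 0"
    "\<And>y z. y \<in> S \<Longrightarrow> z \<in> topspace Y \<Longrightarrow> \<phi> (F y) z = 0 \<Longrightarrow> \<phi> f z = 0" by blast
  have "\<phi> f z = 0" if z: "z \<in> topspace Y" for z
  proof -
    obtain y where y: "y \<in> S" "G y z \<noteq> 0" using S(3) z by (auto simp: U_def)
    then have "CI_mult Y (\<phi> (F y)) (G y) = CI_const Y 0" using FG S(2) by blast
    then have "\<phi> (F y) z * G y z = 0" using z by (metis CI_mult_apply CI_const_apply)
    then show ?thesis using f(3) y z by simp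
  qed
  then have "\<phi> f = CI_const Y 0" using CI_eq_zero_iff phi f(1) by blast
  then have "f = CI_const X 0"
    by (metis CI_const_in_CI f(1) order.refl phi_zero psi_phi zero_le_one)
  then show False using f(2) x by simp
qed

text \<open>Choose \<open>h\<close> equal to 1 near \<open>x\<close> and to 0 near
  \<open>x'\<close>, and bumps \<open>f\<close>, \<open>f'\<close> living in these two
  neighbourhoods. From \<open>h f = f\<close> and \<open>h f' = 0\<close>, the function
  \<open>\<phi> h\<close> is 1 where \<open>\<phi> f\<close> is nonzero and 0 where
  \<open>\<phi> f'\<close> is nonzero. Both sets have \<open>y\<close> in their closure.\<close>

lemma rel_unique:
  assumes "rel x y" "rel x' y"
  shows "x = x'"
proof (rule ccontr)
  assume "x \<noteq> x'"
  have xs: "x \<in> topspace X" "x' \<in> topspace X" "y \<in> topspace Y" using assms rel_def by auto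
  have o: "openin X (topspace X - {x'})"
    using closedin_Hausdorff_sing_eq[OF X(2), of x'] xs by (simp add: openin_diff)
  have xx: "x \<in> topspace X - {x'}" using xs \<open>x \<noteq> x'\<close> by simp
  obtain h V W where h: "h \<in> CI X" "openin X V" "x \<in> V" "\<And>v. v \<in> V \<Longrightarrow> h v = 1"
    "openin X W" "topspace X - (topspace X - {x'}) \<subseteq> W" "\<And>w. w \<in> W \<Longrightarrow> h w = 0"
    using compact_Hausdorff_bump[OF X o xx] by metis
  obtain f V1 W1 where f: "f \<in> CI X" "x \<in> V1" "\<And>v. v \<in> V1 \<Longrightarrow> f v = 1"
    "topspace X - V \<subseteq> W1" "\<And>w. w \<in> W1 \<Longrightarrow> f w = 0"
    using compact_Hausdorff_bump[OF X h(2,3)] by metis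
  have x'W: "x' \<in> W" using h xs by auto
  obtain f' V2 W2 where f': "f' \<in> CI X" "x' \<in> V2" "\<And>v. v \<in> V2 \<Longrightarrow> f' v = 1"
    "topspace X - W \<subseteq> W2" "\<And>w. w \<in> W2 \<Longrightarrow> f' w = 0"
    using compact_Hausdorff_bump[OF X h(5) x'W] by metis
  have 1: "CI_mult X h f = f"
    using h f by (intro CI_eqI[OF CI_mult_closed]) auto
  have 2: "CI_mult X h f' = CI_const X 0"
    using h f' by (subst CI_eq_zero_iff[OF CI_mult_closed]) auto
  have "\<phi> h z = 1" if "z \<in> topspace Y" "\<phi> f z \<noteq> 0" for z
    using phi_apply_mult[OF h(1) f(1) that(1)] that unfolding 1 by simp
  then have "\<phi> h y = CI_const Y 1 y"
    by (intro CI_ext_closure[OF phi[OF h(1)] _ rel_closure[OF assms(1) f(1)]]) (use f in auto)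
  moreover have "\<phi> h z = 0" if "z \<in> topspace Y" "\<phi> f' z \<noteq> 0" for z
    using phi_apply_mult[OF h(1) f'(1) that(1)] that unfolding 2 phi_zero by simp
  then have "\<phi> h y = CI_const Y 0 y"
    by (intro CI_ext_closure[OF phi[OF h(1)] _ rel_closure[OF assms(2) f'(1)]]) (use f' in auto)
  ultimately show False using xs by simp
qed

section \<open>The homeomorphism, local dependence and order\<close>

definition \<mu> :: "'b \<Rightarrow> 'a" where "\<mu> y = (THE x. rel x y)"

lemma rel_mu:
  assumes "y \<in> topspace Y"
  shows "rel (\<mu> y) y"
proof -
  obtain x where "CI_iso.rel Y X \<psi> y x" using CI_iso.rel_total[OF dual assms] by blast
  then have "rel x y" by (simp add: rel_dual)
  then show ?thesis unfolding \<mu>_def by (rule theI) (rule rel_unique[OF _ \<open>rel x y\<close>])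
qed

lemma rel_carriers:
  assumes "rel x y"
  shows "x \<in> topspace X" "y \<in> topspace Y"
  using assms by (simp_all add: rel_def)

lemma rel_iff_mu: "rel x y \<longleftrightarrow> y \<in> topspace Y \<and> x = \<mu> y"
  using rel_mu[of y] rel_unique[of x y "\<mu> y"] rel_carriers(2)[of x y] by auto

lemma mu_in [simp]: "y \<in> topspace Y \<Longrightarrow> \<mu> y \<in> topspace X"
  by (rule rel_carriers(1)[OF rel_mu])

lemma mu_dual_mu: "y \<in> topspace Y \<Longrightarrow> CI_iso.\<mu> Y X \<psi> (\<mu> y) = y"
  using CI_iso.rel_iff_mu[OF dual, of y "\<mu> y"] rel_dual rel_mu by simp

text \<open>A bump \<open>h\<close> at \<open>\<mu> y\<close> supported in \<open>U\<close>
  satisfies \<open>h f = h g\<close>. Cancelling \<open>\<phi> h\<close> gives equality of the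
  images where it is nonzero, and \<open>y\<close> lies in the closure of that set.\<close>

lemma phi_local:
  assumes f: "f \<in> CI X" "g \<in> CI X" and U: "openin X U" "\<mu> y \<in> U" and eq: "\<And>u. u \<in> U \<Longrightarrow> f u = g u"
    and y: "y \<in> topspace Y"
  shows "\<phi> f y = \<phi> g y"
proof -
  obtain h V W where h: "h \<in> CI X" "\<mu> y \<in> V" "\<And>v. v \<in> V \<Longrightarrow> h v = 1"
    "topspace X - U \<subseteq> W" "\<And>w. w \<in> W \<Longrightarrow> h w = 0"
    using compact_Hausdorff_bump[OF X U] by metis
  have "CI_mult X h f = CI_mult X h g"
    using h eq f by (intro CI_eqI[OF CI_mult_closed CI_mult_closed]) auto
  then have "\<phi> h z * \<phi> f z = \<phi> h z * \<phi> g z" if "z \<in> topspace Y" for z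
    by (metis f h(1) phi_apply_mult that)
  then have "\<phi> f z = \<phi> g z" if "z \<in> topspace Y" "\<phi> h z \<noteq> 0" for z
    using that mult_left_cancel by blast
  then show ?thesis
    by (intro CI_ext_closure[OF phi[OF f(1)] phi[OF f(2)] rel_closure[OF rel_mu[OF y] h(1)]]) (use h in auto)
qed

text \<open>For a bump \<open>h\<close> at \<open>\<mu> y\<close> supported in \<open>U\<close>, the
  set where \<open>\<phi> h\<close> is nonzero is the required neighbourhood. By locality it
  contains \<open>y\<close>, since \<open>h\<close> has the germ of 1 at \<open>\<mu> y\<close>, and
  omits each \<open>z\<close> with \<open>\<mu> z\<close> outside \<open>U\<close>, since
  \<open>h\<close> has the germ of 0 there.\<close>

lemma continuous_map_mu: "continuous_map Y X \<mu>"
  unfolding continuous_map_def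
proof (intro conjI allI impI)
  show "\<mu> \<in> topspace Y \<rightarrow> topspace X" by simp
next
  fix U assume U: "openin X U"
  show "openin Y {y \<in> topspace Y. \<mu> y \<in> U}"
  proof (subst openin_subopen, intro ballI)
    fix y assume "y \<in> {y \<in> topspace Y. \<mu> y \<in> U}"
    then have y: "y \<in> topspace Y" "\<mu> y \<in> U" by auto
    obtain h V W where h: "h \<in> CI X" "openin X V" "\<mu> y \<in> V" "\<And>v. v \<in> V \<Longrightarrow> h v = 1"
      "openin X W" "topspace X - U \<subseteq> W" "\<And>w. w \<in> W \<Longrightarrow> h w = 0"
      using compact_Hausdorff_bump[OF X U y(2)] by metis
    have "\<phi> h y = \<phi> (CI_const X 1) y"
      using h openin_subset[OF h(2)] by (intro phi_local[OF _ _ h(2,3) _ y(1)]) auto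
    then have 1: "\<phi> h y \<noteq> 0" using y by (simp add: phi_one)
    have "\<mu> z \<in> U" if z: "z \<in> topspace Y" "\<phi> h z \<noteq> 0" for z
    proof (rule ccontr)
      assume "\<mu> z \<notin> U"
      then have "\<mu> z \<in> W" using h z by auto
      then have "\<phi> h z = \<phi> (CI_const X 0) z"
        using h openin_subset[OF h(5)] by (intro phi_local[OF _ _ h(5) _ _ z(1)]) auto
      with z show False by (simp add: phi_zero)
    qed
    with 1 y openin_nonzero[OF phi[OF h(1)]]
    show "\<exists>T. openin Y T \<and> y \<in> T \<and> T \<subseteq> {y \<in> topspace Y. \<mu> y \<in> U}" 
      by (intro exI[of _ "{z \<in> topspace Y. \<phi> h z \<noteq> 0}"]) auto
  qed
qed

lemma homeomorphic_maps_mu: "homeomorphic_maps Y X \<mu> (CI_iso.\<mu> Y X \<psi>)"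
  unfolding homeomorphic_maps_def
proof (intro conjI ballI)
  interpret D: CI_iso Y X \<psi> \<phi> by (rule dual)
  show "continuous_map Y X \<mu>" "continuous_map X Y D.\<mu>"
    by (rule continuous_map_mu D.continuous_map_mu)+
  show "D.\<mu> (\<mu> y) = y" if "y \<in> topspace Y" for y using that by (rule mu_dual_mu)
  show "\<mu> (D.\<mu> x) = x" if "x \<in> topspace X" for x using D.mu_dual_mu that by blast
qed

lemma phi_range: "f \<in> CI X \<Longrightarrow> y \<in> topspace Y \<Longrightarrow> 0 \<le> \<phi> f y \<and> \<phi> f y \<le> 1"
  using CI_D(2,3)[OF phi] by blast

text \<open>The strict inequality persists near \<open>\<mu> y\<close>, where \<open>g\<close> also
  stays above half its value. Hence \<open>f = g k\<close> locally with \<open>k\<close> the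
  quotient, truncated so as to lie in \<open>CI X\<close> globally, and the factor
  \<open>\<phi> k\<close> is at most 1.\<close>

lemma phi_less:
  assumes f: "f \<in> CI X" and g: "g \<in> CI X" and y: "y \<in> topspace Y" and less: "f (\<mu> y) < g (\<mu> y)"
  shows "\<phi> f y \<le> \<phi> g y"
proof -
  define e where "e = g (\<mu> y) / 2"
  have x: "\<mu> y \<in> topspace X" using y by simp
  have e: "0 < e" "e < g (\<mu> y)" using less CI_D(2)[OF f x] by (auto simp: e_def)
  define k where "k = (\<lambda>z\<in>topspace X. min 1 (f z / max (g z) e))"
  have k: "k \<in> CI X"
    unfolding k_def
  proof (rule restrict_in_CI)
    show "continuous_map X euclideanreal (\<lambda>z. min 1 (f z / max (g z) e))"
      using e by (intro continuous_intros CI_D(1)[OF f] CI_D(1)[OF g]) auto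
    show "min 1 (f z / max (g z) e) \<in> {0..1}" if "z \<in> topspace X" for z
      using e CI_D(2)[OF f that] by (auto intro!: divide_nonneg_nonneg)
  qed
  let ?U = "{z \<in> topspace X. f z < g z} \<inter> {z \<in> topspace X. e < g z}"
  have U: "openin X ?U"
    using openin_less[OF CI_D(1)[OF f] CI_D(1)[OF g]] openin_less[OF _ CI_D(1)[OF g], of "\<lambda>_. e"]
    by (intro openin_Int) auto
  have "\<phi> f y = \<phi> (CI_mult X g k) y"
    by (rule phi_local[OF f CI_mult_closed[OF g k] U _ _ y]) (use e less x in \<open>auto simp: k_def\<close>)
  also have "\<dots> = \<phi> g y * \<phi> k y" by (rule phi_apply_mult[OF g k y])
  also have "\<dots> \<le> \<phi> g y" using phi_range[OF g y] phi_range[OF k y] by (simp add: mult_left_le)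
  finally show ?thesis .
qed

section \<open>The exponent and the power formula on \<open>Z\<close>\<close>

definition \<gamma> :: "'b \<Rightarrow> real" where "\<gamma> = \<phi> (CI_const X (exp (-1)))"

definition Z :: "'b set" where "Z = {y \<in> topspace Y. 0 < \<gamma> y \<and> \<gamma> y < 1}"

definition p :: "'b \<Rightarrow> real" where "p y = - ln (\<gamma> y)"

lemma gamma_CI: "\<gamma> \<in> CI Y"
  by (simp add: \<gamma>_def phi)

lemma Z_subset: "Z \<subseteq> topspace Y"
  by (auto simp: Z_def)

lemma openin_Z: "openin Y Z"
proof -
  have "Z = {y \<in> topspace Y. 0 < \<gamma> y} \<inter> {y \<in> topspace Y. \<gamma> y < 1}" by (auto simp: Z_def)
  then show ?thesis
    using openin_less[OF _ CI_D(1)[OF gamma_CI], of "\<lambda>_. 0"] openin_less[OF CI_D(1)[OF gamma_CI], of "\<lambda>_. 1"]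
    by auto
qed

lemma p_pos: "y \<in> Z \<Longrightarrow> 0 < p y"
  by (simp add: Z_def p_def)

lemma exp_p: "y \<in> Z \<Longrightarrow> exp (- p y) = \<gamma> y"
  by (simp add: Z_def p_def)

lemma continuous_map_p: "continuous_map (subtopology Y Z) euclideanreal p"
proof -
  have "continuous_map (subtopology Y Z) euclideanreal \<gamma>"
    by (rule continuous_map_from_subtopology[OF CI_D(1)[OF gamma_CI]])
  then show ?thesis
    unfolding p_def continuous_map_atin limitin_canonical_iff
    by (auto intro!: tendsto_minus tendsto_ln simp: Z_def)
qed

text \<open>Trapping \<open>n * t\<close> between consecutive integers suffices: the error in the exponent is at most
  \<open>p y / n\<close>.\<close>

lemma phi_const:
  assumes y: "y \<in> Z" and t: "0 \<le> t"
  shows "\<phi> (CI_const X (exp (- t))) y = exp (- t * p y)"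
proof -
  have yY: "y \<in> topspace Y" using y by (simp add: Z_def)
  define A where "A s = \<phi> (CI_const X (exp (- s))) y" for s
  have add: "A (r + s) = A r * A s" if "0 \<le> r" "0 \<le> s" for r s
    unfolding A_def using that yY
    by (subst phi_apply_mult[symmetric]) (simp_all add: CI_mult_const exp_add[symmetric])
  have A01: "0 \<le> A s" "A s \<le> 1" if "0 \<le> s" for s
    using phi_range yY that by (auto simp: A_def)
  have anti: "A s \<le> A r" if "0 \<le> r" "r \<le> s" for r s
    using add[of r "s - r"] A01[of r] A01[of "s - r"] that by (simp add: mult_left_le)
  have A0: "A 0 = 1" using yY by (simp add: A_def phi_one)
  have pow: "A (real n * s) = A s ^ n" if "0 \<le> s" for n s
  proof (induction n)
    case (Suc n)
    then show ?case using add[of s "real n * s"] that by (simp add: algebra_simps)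
  qed (simp add: A0)
  have A1: "A 1 = exp (- p y)" using exp_p[OF y] by (simp add: A_def \<gamma>_def)
  have An: "A (real n) = exp (- real n * p y)" for n
    using pow[of 1 n] by (simp add: A1 exp_of_nat_mult[symmetric])
  have est: "A t > 0 \<and> real n * \<bar>ln (A t) + t * p y\<bar> \<le> p y" if n: "0 < n" for n
  proof -
    define m where "m = nat \<lfloor>real n * t\<rfloor>"
    have m: "real m \<le> real n * t" "real n * t \<le> real m + 1"
      using t unfolding m_def by simp_all
    have 1: "A (real m + 1) \<le> A t ^ n" "A t ^ n \<le> A (real m)"
      using anti[of "real n * t" "real m + 1"] anti[of "real m" "real n * t"] m t pow[OF t, of n] by auto
    have 2: "A (real m + 1) = exp (- (real m + 1) * p y)" using An[of "Suc m"] by (simp add: add.commute)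
    then have "A t ^ n > 0" using 1 exp_gt_zero less_le_trans by metis
    then have pos: "A t > 0" using A01(1)[OF t] n by (metis less_eq_real_def zero_power less_irrefl)
    have "- (real m + 1) * p y \<le> ln (A t ^ n)"
      using 1(1) \<open>A t ^ n > 0\<close> unfolding 2 by (simp add: ln_ge_iff)
    moreover have "ln (A t ^ n) \<le> - real m * p y"
      using 1(2) \<open>A t ^ n > 0\<close> unfolding An by (metis exp_gt_zero ln_exp ln_mono)
    moreover have "ln (A t ^ n) = real n * ln (A t)" using pos by (simp add: ln_realpow)
    moreover have "real m * p y \<le> real n * t * p y" "real n * t * p y \<le> (real m + 1) * p y"
      using m p_pos[OF y] by (simp_all add: mult_right_mono)
    ultimately have "\<bar>real n * (ln (A t) + t * p y)\<bar> \<le> p y"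
      by (simp add: algebra_simps abs_le_iff)
    with pos show ?thesis by (simp add: abs_mult)
  qed
  \<comment> \<open>By \<open>est\<close>, all positive integer multiples of the absolute value are
    bounded by the fixed number \<open>p y\<close>, so the Archimedean property forces it to be
    0.\<close>
  have "ln (A t) + t * p y = 0"
  proof (rule ccontr)
    assume "ln (A t) + t * p y \<noteq> 0"
    then obtain n where n: "p y < real n * \<bar>ln (A t) + t * p y\<bar>"
      using ex_less_of_nat_mult[of "\<bar>ln (A t) + t * p y\<bar>" "p y"] by auto
    then have "0 < n" using p_pos[OF y] by (cases n) auto
    with n est[of n] show False by simp
  qed
  then have "ln (A t) = - t * p y" by simp
  with est[of 1] show ?thesis by (metis A_def exp_ln zero_less_one)
qed

text \<open>Constants just above and below \<open>f (\<mu> y)\<close> squeeze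
  \<open>\<phi> f y\<close> through \<open>phi_less\<close>, and their images are given by
  \<open>phi_const\<close>. If the root \<open>w\<close> of the value differed from
  \<open>f (\<mu> y)\<close>, a constant strictly between the two would contradict strict
  monotonicity of the power.\<close>

lemma phi_on_Z:
  assumes y: "y \<in> Z" and f: "f \<in> CI X"
  shows "\<phi> f y = f (\<mu> y) powr p y"
proof -
  have yY: "y \<in> topspace Y" using y by (simp add: Z_def)
  define a v where "a = f (\<mu> y)" and "v = \<phi> f y"
  have a: "0 \<le> a" "a \<le> 1" using CI_D(2,3)[OF f] yY by (auto simp: a_def)
  have v: "0 \<le> v" "v \<le> 1" using phi_range[OF f yY] by (auto simp: v_def)
  have p: "0 < p y" using p_pos y by blast
  have c: "\<phi> (CI_const X c) y = c powr p y" if "0 < c" "c \<le> 1" for c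
    using phi_const[OF y, of "- ln c"] that by (simp add: powr_def mult.commute)
  have up: "v \<le> c powr p y" if "a < c" "c \<le> 1" for c
    using phi_less[OF f, of "CI_const X c" y] c[of c] that a yY by (simp add: a_def v_def)
  have lo: "c powr p y \<le> v" if "0 < c" "c < a" for c
    using phi_less[OF _ f, of "CI_const X c" y] c[of c] that a yY by (simp add: a_def v_def)
  define w where "w = v powr (1 / p y)"
  have w: "w powr p y = v" "0 \<le> w" "w \<le> 1"
    using v p by (auto simp: w_def powr_powr powr_le1)
  have "w = a"
  proof (rule linorder_cases)
    assume "w < a"
    then obtain c where c: "w < c" "c < a" using dense by blast
    then have "c powr p y \<le> v" using lo w by simp
    moreover have "w powr p y < c powr p y" using powr_less_mono2[of "p y" w c] c w(2) p by simp
    ultimately show ?thesis using w by simp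
  next
    assume "a < w"
    then obtain c where c: "a < c" "c < w" using dense by blast
    then have "v \<le> c powr p y" using up w by simp
    moreover have "c powr p y < w powr p y" using powr_less_mono2[of "p y" c w] c p a by simp
    ultimately show ?thesis using w by simp
  qed
  then show ?thesis using w by (simp add: a_def v_def)
qed

text \<open>Inverts \<open>phi_on_Z\<close> at \<open>\<psi> g\<close>. The version of
  \<open>phi_on_Z\<close> from \<open>dual\<close> would bring in the exponent and the set belonging
  to the inverse instead of \<open>p\<close> and \<open>Z\<close>.\<close>

lemma psi_on_Z:
  assumes y: "y \<in> Z" and g: "g \<in> CI Y"
  shows "\<psi> g (\<mu> y) = g y powr (1 / p y)"
proof -
  have "g y = \<psi> g (\<mu> y) powr p y"
    using phi_on_Z[OF y psi[OF g]] phi_psi[OF g] by simp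
  moreover have "0 \<le> \<psi> g (\<mu> y)"
    using CI_D(2)[OF psi[OF g]] y by (simp add: Z_def)
  ultimately show ?thesis using p_pos[OF y] by (simp add: powr_powr)
qed

text \<open>Off \<open>Z\<close> the values of \<open>\<gamma>\<close> are 0 or 1, hence idempotent.
  A bump \<open>h\<close> supported off \<open>Z\<close> thus satisfies
  \<open>h \<gamma> \<gamma> = h \<gamma>\<close>. Pulled back by \<open>\<psi>\<close>,
  \<open>\<gamma>\<close> becomes the non-idempotent constant 1/e, which forces
  \<open>\<psi> h = 0\<close>.\<close>

lemma Z_dense: "Y closure_of Z = topspace Y"
proof (rule ccontr)
  assume "Y closure_of Z \<noteq> topspace Y"
  then obtain y where y: "y \<in> topspace Y" "y \<notin> Y closure_of Z"
    using closure_of_subset_topspace by fast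
  then obtain T where T: "openin Y T" "y \<in> T" "T \<inter> Z = {}"
    unfolding in_closure_of by blast
  obtain h V W where h: "h \<in> CI Y" "y \<in> V" "\<And>v. v \<in> V \<Longrightarrow> h v = 1"
    "topspace Y - T \<subseteq> W" "\<And>w. w \<in> W \<Longrightarrow> h w = 0"
    using compact_Hausdorff_bump[OF Y T(1,2)] by metis
  let ?e = "CI_const X (exp (-1))"
  have e: "?e \<in> CI X" by simp
  have idem: "h z * (\<gamma> z * \<gamma> z) = h z * \<gamma> z" if z: "z \<in> topspace Y" for z
  proof (cases "z \<in> T")
    case True
    then have "\<not> (0 < \<gamma> z \<and> \<gamma> z < 1)" using T(3) z by (auto simp: Z_def)
    moreover have "0 \<le> \<gamma> z" "\<gamma> z \<le> 1" using CI_D(2,3)[OF gamma_CI z] by auto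
    ultimately have "\<gamma> z = 0 \<or> \<gamma> z = 1" by linarith
    then show ?thesis by auto
  next
    case False
    then show ?thesis using h z by auto
  qed
  have "CI_mult Y h (CI_mult Y \<gamma> \<gamma>) = CI_mult Y h \<gamma>"
    by (rule CI_eqI[where X=Y]) (simp_all add: CI_mult_closed h(1) gamma_CI idem)
  moreover have "\<psi> \<gamma> = ?e" by (simp add: \<gamma>_def psi_phi)
  ultimately have eq: "CI_mult X (\<psi> h) (CI_mult X ?e ?e) = CI_mult X (\<psi> h) ?e"
    using psi_mult[OF h(1) CI_mult_closed[OF gamma_CI gamma_CI]] psi_mult[OF h(1) gamma_CI]
      psi_mult[OF gamma_CI gamma_CI] by simp
  have "\<psi> h x = 0" if x: "x \<in> topspace X" for x
  proof -
    have "\<psi> h x * (exp (-1) * exp (-1)) = \<psi> h x * exp (-1)"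
      using arg_cong[OF eq, of "\<lambda>f. f x"] x by simp
    moreover have "exp (-1::real) * exp (-1) \<noteq> exp (-1)" by simp
    ultimately show ?thesis by (metis mult_left_cancel)
  qed
  then have "\<psi> h = CI_const X 0" using CI_eq_zero_iff[OF psi[OF h(1)]] by blast
  then have "h = CI_const Y 0" using phi_psi[OF h(1)] phi_zero by simp
  then show False using h(2,3) y(1) by fastforce
qed

section \<open>The case of full \<open>Z\<close>, and the Stone-Cech property of
  \<open>Z\<close>\<close>

lemma standard_if_Z_full:
  assumes "Z = topspace Y"
  shows "standard_map X Y \<phi>"
  unfolding standard_map_def
proof (intro exI conjI ballI)
  show "homeomorphic_map Y X \<mu>"
    using homeomorphic_maps_mu homeomorphic_map_maps by blast
  show "continuous_map Y (top_of_set {0<..}) p"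
    using continuous_map_p p_pos by (auto simp: continuous_map_in_subtopology assms)
  show "\<phi> f y = f (\<mu> y) powr p y" if "f \<in> CI X" "y \<in> topspace Y" for f y
    using phi_on_Z that assms by simp
qed

text \<open>A bound \<open>B\<close> for the reciprocal would keep
  \<open>\<gamma> (1 - \<gamma>)\<close> at least \<open>1 / B\<close> on \<open>Z\<close>, and by
  density on \<open>Y\<close>, although it vanishes at points off \<open>Z\<close>.\<close>

lemma Z_not_pseudocompact:
  assumes "Z \<noteq> topspace Y"
  shows "\<not> pseudocompact_space (subtopology Y Z)"
proof
  assume pc: "pseudocompact_space (subtopology Y Z)"
  obtain y where y: "y \<in> topspace Y" "y \<notin> Z" using assms Z_subset by blast
  let ?r = "\<lambda>z. \<gamma> z * (1 - \<gamma> z)"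
  have c: "continuous_map Y euclideanreal ?r"
    by (intro continuous_intros CI_D(1)[OF gamma_CI])
  have pos: "0 < ?r z" if "z \<in> Z" for z using that by (simp add: Z_def)
  have "continuous_map (subtopology Y Z) euclideanreal (\<lambda>z. 1 / ?r z)"
    using pos by (intro continuous_map_real_divide continuous_map_from_subtopology[OF c]) force+
  with pc have "bounded ((\<lambda>z. 1 / ?r z) ` topspace (subtopology Y Z))"
    unfolding pseudocompact_space_def by blast
  moreover have "topspace (subtopology Y Z) = Z" using Z_subset by auto
  ultimately obtain B where B: "0 < B" "\<And>z. z \<in> Z \<Longrightarrow> \<bar>1 / ?r z\<bar> \<le> B"
    unfolding bounded_pos by auto
  have ge: "1 / B \<le> ?r z" if "z \<in> Z" for z
    using B(2)[OF that] B(1) pos[OF that] by (simp add: field_simps)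
  have "closedin Y {z \<in> topspace Y. ?r z \<in> {1 / B..}}"
    by (rule closedin_continuous_map_preimage[OF c]) simp
  then have "1 / B \<le> ?r y"
    using forall_in_closure_of[of y Y Z "\<lambda>z. 1 / B \<le> ?r z"] Z_dense ge y(1) by simp
  then have "0 < ?r y" using B(1) by (simp add: less_le_trans[rotated])
  then have "0 < \<gamma> y \<and> \<gamma> y < 1" using CI_D(2,3)[OF gamma_CI y(1)]
    by (simp add: zero_less_mult_iff)
  with y show False by (simp add: Z_def)
qed

text \<open>The factor \<open>p / (1 + p\<^sup>2)\<close> vanishes where \<open>p\<close> tends to \<open>0\<close> or \<open>\<infinity>\<close>, that is, off \<open>Z\<close>, so the
  damped function is continuous on all of \<open>Y\<close>; multiplied by \<open>p\<close> and \<open>1 / p\<close>, the effect of \<open>\<phi>\<close>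
  and \<open>\<psi>\<close> on exponents, it yields two functions whose sum is \<open>f\<close>.\<close>

definition damp :: "('b \<Rightarrow> real) \<Rightarrow> 'b \<Rightarrow> real" where
  "damp f y = (if y \<in> Z then f y * (p y / (1 + p y * p y)) else 0)"

lemma damp_continuous:
  assumes f: "continuous_map (subtopology Y Z) euclideanreal f"
    and f01: "\<And>z. z \<in> Z \<Longrightarrow> 0 \<le> f z \<and> f z \<le> 1"
  shows "continuous_map Y euclideanreal (damp f)"
proof (rule continuous_map_real_epsilon)
  fix y and e :: real
  assume y: "y \<in> topspace Y" and e: "0 < e"
  have tZ: "topspace (subtopology Y Z) = Z" using Z_subset by auto
  \<comment> \<open>One bound for each way of leaving \<open>Z\<close>: \<open>p\<close> tends to 0
    where \<open>\<gamma>\<close> tends to 1, and \<open>1 / p\<close> tends to 0 where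
    \<open>\<gamma>\<close> tends to 0.\<close>
  have bnd: "\<bar>damp f z\<bar> \<le> p z" "\<bar>damp f z\<bar> \<le> 1 / p z" if z: "z \<in> Z" for z
  proof -
    have p: "0 < p z" by (rule p_pos[OF z])
    have q: "0 < 1 + p z * p z" using p by (simp add: add_pos_pos)
    have "0 \<le> damp f z" using f01[OF z] p q z by (simp add: damp_def)
    moreover have "damp f z \<le> p z / (1 + p z * p z)"
      using f01[OF z] p q z mult_right_mono[of "f z" 1 "p z / (1 + p z * p z)"] by (simp add: damp_def)
    moreover have "p z / (1 + p z * p z) \<le> p z" "p z / (1 + p z * p z) \<le> 1 / p z"
      using p q by (simp_all add: field_simps)
    ultimately show "\<bar>damp f z\<bar> \<le> p z" "\<bar>damp f z\<bar> \<le> 1 / p z" by linarith+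
  qed
  show "\<exists>T. openin Y T \<and> y \<in> T \<and> (\<forall>z\<in>T. \<bar>damp f z - damp f y\<bar> < e)"
  proof (cases "y \<in> Z")
    case True
    have "1 + p z * p z \<noteq> 0" for z using zero_le_square[of "p z"] by linarith
    then have "continuous_map (subtopology Y Z) euclideanreal (\<lambda>z. f z * (p z / (1 + p z * p z)))"
      by (intro continuous_intros f continuous_map_p) auto
    then have "continuous_map (subtopology Y Z) euclideanreal (damp f)"
      by (rule continuous_map_eq) (simp add: damp_def)
    then have "openin (subtopology Y Z) {z \<in> topspace (subtopology Y Z). damp f z \<in> ball (damp f y) e}"
      by (rule openin_continuous_map_preimage) simp
    then have "openin Y {z \<in> Z. damp f z \<in> ball (damp f y) e}"
      unfolding tZ by (rule openin_trans_full) (rule openin_Z)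
    then show ?thesis
      using True e by (intro exI[of _ "{z \<in> Z. damp f z \<in> ball (damp f y) e}"])
        (auto simp: dist_real_def abs_minus_commute)
  next
    case False
    have g: "0 \<le> \<gamma> y" "\<gamma> y \<le> 1" using CI_D(2,3)[OF gamma_CI y] by auto
    with False y consider "\<gamma> y = 0" | "\<gamma> y = 1" by (force simp: Z_def)
    then show ?thesis
    proof cases
      case 1
      \<comment> \<open>On \<open>Z\<close> this threshold for \<open>\<gamma>\<close> says exactly
        \<open>p z > 1 / e\<close>.\<close>
      let ?T = "{z \<in> topspace Y. \<gamma> z < exp (- (1 / e))}"
      have "openin Y ?T" using openin_less[OF CI_D(1)[OF gamma_CI], of "\<lambda>_. exp (- (1 / e))"] by simp
      moreover have "\<bar>damp f z\<bar> < e" if z: "z \<in> ?T" for z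
      proof (cases "z \<in> Z")
        case True
        then have "exp (- p z) < exp (- (1 / e))" using z by (simp add: exp_p)
        then have "1 / e < p z" by simp
        then have "1 / p z < e" using e p_pos[OF True] by (simp add: field_simps)
        with bnd(2)[OF True] show ?thesis by linarith
      qed (use e in \<open>simp add: damp_def\<close>)
      ultimately show ?thesis using y 1 False by (intro exI[of _ ?T]) (auto simp: damp_def)
    next
      case 2
      \<comment> \<open>On \<open>Z\<close> this threshold says exactly
        \<open>p z < e\<close>.\<close>
      let ?T = "{z \<in> topspace Y. exp (- e) < \<gamma> z}"
      have "openin Y ?T" using openin_less[OF _ CI_D(1)[OF gamma_CI], of "\<lambda>_. exp (- e)"] by simp
      moreover have "\<bar>damp f z\<bar> < e" if z: "z \<in> ?T" for z
      proof (cases "z \<in> Z")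
        case True
        then have "exp (- e) < exp (- p z)" using z by (simp add: exp_p)
        then have "p z < e" by simp
        with bnd(1)[OF True] show ?thesis by linarith
      qed (use e in \<open>simp add: damp_def\<close>)
      ultimately show ?thesis using y 2 e False by (intro exI[of _ ?T]) (auto simp: damp_def)
    qed
  qed
qed

lemma stone_cech_Z: "stone_cech_of_subset Y Z"
  unfolding stone_cech_of_subset_def
proof (intro conjI allI impI Y Z_subset Z_dense)
  fix f assume f: "continuous_map (subtopology Y Z) (top_of_set {0..1::real}) f"
  have fc: "continuous_map (subtopology Y Z) euclideanreal f"
    using f continuous_map_into_fulltopology by blast
  have f01: "0 \<le> f z \<and> f z \<le> 1" if "z \<in> Z" for z
    using f Z_subset that by (auto simp: continuous_map_in_subtopology Pi_iff)
  interpret D: CI_iso Y X \<psi> \<phi> by (rule dual)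
  have "0 \<le> damp f z" for z
  proof (cases "z \<in> Z")
    case True
    then show ?thesis
      using f01[OF True] p_pos[OF True]
      by (auto simp: damp_def intro!: divide_nonneg_nonneg add_nonneg_nonneg)
  qed (simp add: damp_def)
  then have h01: "exp (- damp f z) \<in> {0..1}" for z by simp
  have hc: "continuous_map Y euclideanreal (\<lambda>z. exp (- damp f z))"
    using damp_continuous[OF fc f01] by (simp add: continuous_map_atin tendsto_exp tendsto_minus)
  define h where "h = (\<lambda>y\<in>topspace Y. exp (- damp f y))"
  \<comment> \<open>The same function carried over to \<open>X\<close>, so that
    \<open>\<phi>\<close> can act on it while \<open>\<psi>\<close> acts on
    \<open>h\<close>.\<close>
  define h' where "h' = (\<lambda>x\<in>topspace X. exp (- damp f (D.\<mu> x)))"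
  have h: "h \<in> CI Y" unfolding h_def using hc h01 by (rule restrict_in_CI)
  have "continuous_map X euclideanreal (\<lambda>x. exp (- damp f (D.\<mu> x)))"
    using continuous_map_compose[OF D.continuous_map_mu hc] by (simp add: o_def)
  then have h': "h' \<in> CI X" unfolding h'_def using h01 by (rule restrict_in_CI)
  \<comment> \<open>On \<open>Z\<close> the two factors have exponents \<open>- damp f * p\<close>
    and \<open>- damp f / p\<close>, which add up to \<open>- f\<close>.\<close>
  define k where "k y = \<phi> h' y * \<psi> h (\<mu> y)" for y
  have kc: "continuous_map Y euclideanreal k"
    unfolding k_def
    using continuous_map_compose[OF continuous_map_mu CI_D(1)[OF psi[OF h]]]
    by (intro continuous_map_real_mult CI_D(1)[OF phi[OF h']]) (simp add: o_def)
  have kZ: "k z = exp (- f z)" if z: "z \<in> Z" for z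
  proof -
    have zY: "z \<in> topspace Y" using z Z_subset by blast
    have p: "0 < p z" by (rule p_pos[OF z])
    have "\<phi> h' z = exp (- damp f z * p z)"
      using phi_on_Z[OF z h'] zY mu_dual_mu[OF zY] by (simp add: h'_def exp_powr)
    moreover have "\<psi> h (\<mu> z) = exp (- damp f z * (1 / p z))"
      using psi_on_Z[OF z h] zY by (simp add: h_def exp_powr)
    ultimately have "k z = exp (- damp f z * p z + - damp f z * (1 / p z))"
      by (simp only: k_def exp_add)
    moreover have "- damp f z * p z + - damp f z * (1 / p z) = - f z"
    proof -
      have q: "1 + p z * p z \<noteq> 0" using p by (metis add_pos_pos mult_pos_pos zero_less_one less_irrefl)
      have "damp f z * p z + damp f z * (1 / p z) = f z * ((p z * p z + 1) / (1 + p z * p z))"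
        using z p by (simp add: damp_def add_divide_distrib distrib_left)
      also have "\<dots> = f z" using q by (simp add: add.commute)
      finally show ?thesis by simp
    qed
    ultimately show ?thesis by simp
  qed
  \<comment> \<open>The cutoff at \<open>exp (-1)\<close> keeps the logarithm continuous on all of
    \<open>Y\<close>. Since \<open>f\<close> takes values in \<open>[0,1]\<close>, neither it nor
    the clamping changes anything on \<open>Z\<close>.\<close>
  define g where "g y = min 1 (max 0 (- ln (max (k y) (exp (-1)))))" for y
  show "\<exists>g. continuous_map Y (top_of_set {0..1}) g \<and> (\<forall>z\<in>Z. g z = f z)"
  proof (intro exI conjI ballI)
    have "continuous_map Y euclideanreal (\<lambda>y. max (k y) (exp (-1)))"
      by (intro continuous_intros kc)
    moreover have "max (k y) (exp (-1)) \<noteq> 0" for y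
      using exp_gt_zero[of "-1"] by linarith
    ultimately have "continuous_map Y euclideanreal (\<lambda>y. ln (max (k y) (exp (-1))))"
      unfolding continuous_map_atin limitin_canonical_iff by (auto intro: tendsto_ln)
    then have "continuous_map Y euclideanreal g"
      unfolding g_def by (intro continuous_intros)
    then show "continuous_map Y (top_of_set {0..1}) g"
      by (auto simp: continuous_map_in_subtopology g_def)
    show "g z = f z" if z: "z \<in> Z" for z
    proof -
      have "max (k z) (exp (-1)) = exp (- f z)" using kZ[OF z] f01[OF z] by (simp add: max_def)
      then show ?thesis using f01[OF z] by (simp add: g_def)
    qed
  qed
qed

end

section \<open>Nonstandard bijections from non-pseudocompact subsets\<close>

lemma stone_cech_CI_extension:
  assumes "stone_cech_of_subset Y Z" "continuous_map (subtopology Y Z) euclideanreal f"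
    and "\<And>z. z \<in> Z \<Longrightarrow> f z \<in> {0..1}"
  shows "\<exists>g. g \<in> CI Y \<and> (\<forall>z\<in>Z. g z = f z)"
proof -
  have "continuous_map (subtopology Y Z) (top_of_set {0..1}) f"
    using assms by (auto simp: continuous_map_in_subtopology)
  then obtain g where g: "continuous_map Y (top_of_set {0..1}) g" "\<forall>z\<in>Z. g z = f z"
    using assms(1) unfolding stone_cech_of_subset_def by meson
  have "restrict g (topspace Y) \<in> CI Y"
    using g(1) by (intro restrict_in_CI) (auto simp: continuous_map_in_subtopology)
  moreover have "Z \<subseteq> topspace Y" using assms(1) unfolding stone_cech_of_subset_def by blast
  ultimately show ?thesis using g(2) by (intro exI[of _ "restrict g (topspace Y)"]) auto
qed

lemma powr_unit: "0 \<le> a \<Longrightarrow> a \<le> 1 \<Longrightarrow> 0 \<le> b \<Longrightarrow> a powr b \<in> {0..1::real}"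
  by (simp add: powr_le1)

lemma nonstandard_map_exists:
  fixes X :: "'a topology" and Y :: "'b topology"
  assumes XY: "X homeomorphic_space Y" and npc: "\<not> pseudocompact_space (subtopology Y Z)"
    and sc: "stone_cech_of_subset Y Z"
  shows "\<exists>\<phi>. bij_betw \<phi> (CI X) (CI Y) \<and> multiplicative_map X Y \<phi> \<and> \<not> standard_map X Y \<phi>"
proof -
  obtain h k where hk: "homeomorphic_maps Y X h k"
    using XY homeomorphic_space_sym homeomorphic_space_def by metis
  have hc: "continuous_map Y X h" and kc: "continuous_map X Y k"
    and kh: "\<And>y. y \<in> topspace Y \<Longrightarrow> k (h y) = y" and hk': "\<And>x. x \<in> topspace X \<Longrightarrow> h (k x) = x"
    using hk by (auto simp: homeomorphic_maps_def)
  have hX: "h y \<in> topspace X" if "y \<in> topspace Y" for y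
    using continuous_map_image_subset_topspace[OF hc] that by blast
  have kY: "k x \<in> topspace Y" if "x \<in> topspace X" for x
    using continuous_map_image_subset_topspace[OF kc] that by blast
  have ZY: "Z \<subseteq> topspace Y" and dense: "Y closure_of Z = topspace Y" and Yc: "compact_space Y"
    using sc by (auto simp: stone_cech_of_subset_def)
  have tZ: "topspace (subtopology Y Z) = Z" using ZY by auto
  \<comment> \<open>By density, the identities for the extended functions need checking only on
    \<open>Z\<close>, where explicit power formulas hold.\<close>
  have unique: "f = g" if "f \<in> CI Y" "g \<in> CI Y" "\<And>z. z \<in> Z \<Longrightarrow> f z = g z" for f g
    using CI_ext_closure[OF that(1,2) _ that(3)] dense by (intro CI_eqI[OF that(1,2)]) auto
  obtain u where u: "continuous_map (subtopology Y Z) euclideanreal u" "\<not> bounded (u ` Z)"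
    using npc unfolding pseudocompact_space_def tZ by blast
  \<comment> \<open>The exponent is unbounded like \<open>u\<close>, and bounded below by 1, so its
    reciprocal is a continuous positive exponent for the inverse.\<close>
  define p where "p z = 1 + \<bar>u z\<bar>" for z
  have pc: "continuous_map (subtopology Y Z) euclideanreal p"
    unfolding p_def by (intro continuous_intros u(1))
  have p: "0 < p z" for z by (simp add: p_def add_pos_nonneg)
  have p'c: "continuous_map (subtopology Y Z) euclideanreal (\<lambda>z. 1 / p z)"
    using p by (intro continuous_intros pc) (metis less_irrefl)
  have "\<exists>g. g \<in> CI Y \<and> (\<forall>z\<in>Z. g z = f (h z) powr p z)" if f: "f \<in> CI X" for f
  proof (rule stone_cech_CI_extension[OF sc])
    have "continuous_map (subtopology Y Z) euclideanreal (f \<circ> h)"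
      by (rule continuous_map_from_subtopology[OF continuous_map_compose[OF hc CI_D(1)[OF f]]])
    then show "continuous_map (subtopology Y Z) euclideanreal (\<lambda>z. f (h z) powr p z)"
      using p pc hX ZY CI_D(2)[OF f] unfolding o_def by (intro continuous_map_real_powr) auto
    show "f (h z) powr p z \<in> {0..1}" if "z \<in> Z" for z
      using CI_D(2,3)[OF f hX] ZY that p[of z] by (intro powr_unit) auto
  qed
  then obtain \<phi> where phi: "\<And>f. f \<in> CI X \<Longrightarrow> \<phi> f \<in> CI Y"
    and phi_Z: "\<And>f z. f \<in> CI X \<Longrightarrow> z \<in> Z \<Longrightarrow> \<phi> f z = f (h z) powr p z" by metis
  have "\<exists>g'. g' \<in> CI Y \<and> (\<forall>z\<in>Z. g' z = g z powr (1 / p z))" if g: "g \<in> CI Y" for g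
  proof (rule stone_cech_CI_extension[OF sc])
    show "continuous_map (subtopology Y Z) euclideanreal (\<lambda>z. g z powr (1 / p z))"
      using p p'c ZY CI_D(2)[OF g]
      by (intro continuous_map_real_powr continuous_map_from_subtopology[OF CI_D(1)[OF g]]) auto
    show "g z powr (1 / p z) \<in> {0..1}" if "z \<in> Z" for z
      using CI_D(2,3)[OF g, of z] ZY that p[of z] by (intro powr_unit) auto
  qed
  then obtain G where G: "\<And>g. g \<in> CI Y \<Longrightarrow> G g \<in> CI Y"
    and G_Z: "\<And>g z. g \<in> CI Y \<Longrightarrow> z \<in> Z \<Longrightarrow> G g z = g z powr (1 / p z)" by metis
  \<comment> \<open>The extension \<open>G g\<close> takes roots on \<open>Y\<close>; composing with
    \<open>k\<close> moves the result to \<open>X\<close>.\<close>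
  define \<psi> where "\<psi> g = (\<lambda>x\<in>topspace X. G g (k x))" for g
  have psi: "\<psi> g \<in> CI X" if g: "g \<in> CI Y" for g
    unfolding \<psi>_def
  proof (rule restrict_in_CI)
    show "continuous_map X euclideanreal (\<lambda>x. G g (k x))"
      using continuous_map_compose[OF kc CI_D(1)[OF G[OF g]]] by (simp add: o_def)
    show "G g (k x) \<in> {0..1}" if "x \<in> topspace X" for x
      using CI_D(2,3)[OF G[OF g] kY[OF that]] by simp
  qed
  have phi_psi: "\<phi> (\<psi> g) = g" if g: "g \<in> CI Y" for g
  proof (rule unique[OF phi[OF psi[OF g]] g])
    fix z assume z: "z \<in> Z"
    have zY: "z \<in> topspace Y" using z ZY by blast
    have "\<phi> (\<psi> g) z = (g z powr (1 / p z)) powr p z"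
      using phi_Z[OF psi[OF g] z] G_Z[OF g z] hX[OF zY] kh[OF zY] by (simp add: \<psi>_def)
    also have "\<dots> = g z" using p[of z] CI_D(2)[OF g zY] by (simp add: powr_powr)
    finally show "\<phi> (\<psi> g) z = g z" .
  qed
  have psi_phi: "\<psi> (\<phi> f) = f" if f: "f \<in> CI X" for f
  proof -
    let ?f = "\<lambda>y\<in>topspace Y. f (h y)"
    have "continuous_map Y euclideanreal (\<lambda>y. f (h y))"
      using continuous_map_compose[OF hc CI_D(1)[OF f]] by (simp add: o_def)
    then have f': "?f \<in> CI Y"
      by (rule restrict_in_CI) (use CI_D(2,3)[OF f hX] in simp)
    have "G (\<phi> f) = ?f"
    proof (rule unique[OF G[OF phi[OF f]] f'])
      fix z assume z: "z \<in> Z"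
      have zY: "z \<in> topspace Y" using z ZY by blast
      have "G (\<phi> f) z = (f (h z) powr p z) powr (1 / p z)"
        using G_Z[OF phi[OF f] z] phi_Z[OF f z] by simp
      then show "G (\<phi> f) z = ?f z"
        using p[of z] CI_D(2)[OF f hX[OF zY]] zY by (simp add: powr_powr)
    qed
    then show ?thesis
      by (intro CI_eqI[OF psi[OF phi[OF f]] f]) (simp add: \<psi>_def kY hk')
  qed
  have "bij_betw \<phi> (CI X) (CI Y)"
    by (rule bij_betwI[where g=\<psi>]) (auto simp: phi psi phi_psi psi_phi)
  moreover have "multiplicative_map X Y \<phi>"
    unfolding multiplicative_map_def
  proof (intro conjI ballI)
    show "\<phi> \<in> CI X \<rightarrow> CI Y" using phi by blast
    fix f g assume f: "f \<in> CI X" and g: "g \<in> CI X"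
    show "\<phi> (CI_mult X f g) = CI_mult Y (\<phi> f) (\<phi> g)"
    proof (rule unique[OF phi[OF CI_mult_closed[OF f g]] CI_mult_closed[OF phi[OF f] phi[OF g]]])
      fix z assume z: "z \<in> Z"
      have zY: "z \<in> topspace Y" using z ZY by blast
      show "\<phi> (CI_mult X f g) z = CI_mult Y (\<phi> f) (\<phi> g) z"
        using phi_Z[OF CI_mult_closed[OF f g] z] phi_Z[OF f z] phi_Z[OF g z] zY hX[OF zY]
          CI_D(2)[OF f hX[OF zY]] CI_D(2)[OF g hX[OF zY]]
        by (simp add: powr_mult)
    qed
  qed
  moreover have "\<not> standard_map X Y \<phi>"
  proof
    assume "standard_map X Y \<phi>"
    then obtain \<nu> q where nu: "homeomorphic_map Y X \<nu>" and q: "continuous_map Y (top_of_set {0<..}) q"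
      and std: "\<And>f y. f \<in> CI X \<Longrightarrow> y \<in> topspace Y \<Longrightarrow> \<phi> f y = f (\<nu> y) powr q y"
      unfolding standard_map_def by metis
    \<comment> \<open>A standard exponent \<open>q\<close> is continuous on the compact space
      \<open>Y\<close> and hence bounded, which \<open>p\<close> is not.\<close>
    have "compactin euclideanreal (q ` topspace Y)"
      using image_compactin[of Y "topspace Y" euclideanreal q] Yc q continuous_map_into_fulltopology
      unfolding compact_space_def by blast
    then have "bounded (q ` topspace Y)" by (simp add: compact_imp_bounded)
    then obtain B where B: "\<And>y. y \<in> topspace Y \<Longrightarrow> \<bar>q y\<bar> \<le> B"
      unfolding bounded_iff by auto
    \<comment> \<open>Testing on the constant 1/e compares the exponents without any relation
      between \<open>\<nu>\<close> and \<open>h\<close>.\<close>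
    have pq: "p z = q z" if z: "z \<in> Z" for z
    proof -
      have zY: "z \<in> topspace Y" using z ZY by blast
      have "\<nu> z \<in> topspace X" using homeomorphic_imp_surjective_map[OF nu] zY by blast
      then have "exp (-1::real) powr p z = exp (-1) powr q z"
        using phi_Z[of "CI_const X (exp (-1))" z] std[of "CI_const X (exp (-1))" z] z zY hX[OF zY] by simp
      then show ?thesis by (simp add: powr_def)
    qed
    have "bounded (u ` Z)"
      unfolding bounded_iff
    proof (intro exI[of _ B] ballI)
      fix a assume "a \<in> u ` Z"
      then obtain z where z: "z \<in> Z" "a = u z" by blast
      have "\<bar>q z\<bar> \<le> B" using B z(1) ZY by blast
      with z pq[OF z(1)] show "norm a \<le> B" by (simp add: p_def)
    qed
    with u(2) show False by blast
  qed
  ultimately show ?thesis by blast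
qed

theorem theorem2p2:
  fixes X :: "'a topology" and Y :: "'b topology"
  assumes "compact_space X" and "Hausdorff_space X"
    and "compact_space Y" and "Hausdorff_space Y"
  shows "(\<exists>\<phi>. bij_betw \<phi> (CI X) (CI Y) \<and> multiplicative_map X Y \<phi> \<and> \<not> standard_map X Y \<phi>)
    \<longleftrightarrow>
    X homeomorphic_space Y \<and>
    (\<exists>Z. Z \<subseteq> topspace Y \<and> \<not> pseudocompact_space (subtopology Y Z) \<and> stone_cech_of_subset Y Z)"
proof
  assume "\<exists>\<phi>. bij_betw \<phi> (CI X) (CI Y) \<and> multiplicative_map X Y \<phi> \<and> \<not> standard_map X Y \<phi>"
  then obtain \<phi> where bij: "bij_betw \<phi> (CI X) (CI Y)" and mult: "multiplicative_map X Y \<phi>"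
    and nonstd: "\<not> standard_map X Y \<phi>" by blast
  interpret CI_iso X Y \<phi> "inv_into (CI X) \<phi>"
  proof
    show "inv_into (CI X) \<phi> g \<in> CI X" if "g \<in> CI Y" for g
      using bij_betw_inv_into[OF bij] bij_betwE that by blast
  qed (use assms mult bij in \<open>auto simp: multiplicative_map_def bij_betw_inv_into_left bij_betw_inv_into_right\<close>)
  have "X homeomorphic_space Y"
    using homeomorphic_maps_mu homeomorphic_space_def homeomorphic_space_sym by metis
  moreover have "Z \<noteq> topspace Y" using standard_if_Z_full nonstd by blast
  ultimately show "X homeomorphic_space Y \<and>
    (\<exists>Z. Z \<subseteq> topspace Y \<and> \<not> pseudocompact_space (subtopology Y Z) \<and> stone_cech_of_subset Y Z)"
    using Z_subset Z_not_pseudocompact stone_cech_Z by blast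
next
  assume "X homeomorphic_space Y \<and>
    (\<exists>Z. Z \<subseteq> topspace Y \<and> \<not> pseudocompact_space (subtopology Y Z) \<and> stone_cech_of_subset Y Z)"
  then show "\<exists>\<phi>. bij_betw \<phi> (CI X) (CI Y) \<and> multiplicative_map X Y \<phi> \<and> \<not> standard_map X Y \<phi>"
    using nonstandard_map_exists by blast
qed

end
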